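(* Let $c\in\{0,N\}$. A Gaussian sequence $[x_k]=(x_0,\dots,x_N)$ of $\mathbb{R}^d$-valued vectors is $CM_c$ if and only if the sequence $[y_k]\setminus\{y_c\}$ is Markov, where $y_k=[x_k',x_c']'$ for $k\in[0,N]\setminus\{c\}$, and $[y_k]\setminus\{y_c\}$ means $[y_k]_0^{N-1}$ for $c=N$ and $[y_k]_1^N$ for $c=0$.
   Context: Sequences are indexed by discrete time $[0,N]=(0,1,\dots,N)$; $[x_k]_i^j=(x_i,\dots,x_j)$; the prime denotes transpose. A Gaussian sequence is jointly Gaussian, with possibly singular covariance. $F(\cdot|\cdot)$ denotes conditional CDF. A sequence $[y_k]_a^b$ is Markov iff conditioned on the state at any time $k$, the segment before $k$ is independent of the segment after $k$; equivalently $F(\eta_k|[y_i]_a^j)=F(\eta_k|y_j)$ (a.s.) for all $a\le j<k\le b$ and all $\eta_k$. Sequences of length smaller than 3 are Markov. For $c\in\{0,N\}$, $[x_k]$ is $CM_c$ iff conditioned on $x_c$ the sequence is Markov over $[1,N]$ (if $c=0$) or over $[0,N-1]$ (if $c=N$); equivalently, $F(\xi_k|[x_i]_0^j,x_c)=F(\xi_k|x_j,x_c)$ (a.s.) for all $j<k$ in $[0,N]$ and all $\xi_k\in\mathbb{R}^d$. *)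

theory Defs
  imports "HOL-Probability.Probability"
begin

text \<open>
  Normal law on the real line, where variance 0 (an almost surely constant variable) is allowed.
\<close>

definition gaussian_rv :: "'a measure \<Rightarrow> ('a \<Rightarrow> real) \<Rightarrow> bool" where
  "gaussian_rv M X \<longleftrightarrow>
     (\<exists>\<mu>. X \<in> borel_measurable M \<and> (AE \<omega> in M. X \<omega> = \<mu>)) \<or>
     (\<exists>\<mu> \<sigma>. \<sigma> > 0 \<and> distributed M lborel X (\<lambda>t. ennreal (normal_density \<mu> \<sigma> t)))"

text \<open>
  Joint Gaussianity, with arbitrary mean and possibly singular covariance: every linear functional
  of the stacked vector of all states is Gaussian.
\<close>

definition gaussian_seq :: "'a measure \<Rightarrow> nat set \<Rightarrow> (nat \<Rightarrow> 'a \<Rightarrow> real ^ 'd) \<Rightarrow> bool" where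
  "gaussian_seq M I x \<longleftrightarrow>
     (\<forall>k\<in>I. x k \<in> borel_measurable M) \<and>
     (\<forall>a :: nat \<Rightarrow> real ^ 'd. gaussian_rv M (\<lambda>\<omega>. \<Sum>k\<in>I. a k \<bullet> x k \<omega>))"

text \<open>
  The sigma-algebra generated by the family \<open>(x i)\<close>, \<open>i \<in> I\<close>; it is trivial
  for empty \<open>I\<close>.
\<close>

definition gen_sigma ::
    "'a measure \<Rightarrow> 'i set \<Rightarrow> ('i \<Rightarrow> 'a \<Rightarrow> 'b::topological_space) \<Rightarrow> 'a measure" where
  "gen_sigma M I x = sigma (space M) {x i -` A \<inter> space M | i A. i \<in> I \<and> A \<in> sets borel}"

definition cond_indep :: "'a measure \<Rightarrow> 'a measure \<Rightarrow> 'a measure \<Rightarrow> 'a measure \<Rightarrow> bool" where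
  "cond_indep M G F H \<longleftrightarrow>
     (\<forall>A\<in>sets F. \<forall>B\<in>sets H. AE \<omega> in M.
        real_cond_exp M G (indicator (A \<inter> B)) \<omega> =
        real_cond_exp M G (indicator A) \<omega> * real_cond_exp M G (indicator B) \<omega>)"

text \<open>
  \<open>markov_given M J I x\<close>: conditioned on the states at the times in \<open>J\<close>, the sequence is Markov
  over the time set \<open>I\<close>, i.e. given those states and the state at any time \<open>k \<in> I\<close>, the segment
  before \<open>k\<close> is independent of the segment after \<open>k\<close>.
  If \<open>I\<close> has fewer than three elements, one of the two segments is always empty and the
  condition holds trivially.
\<close>

definition markov_given ::
    "'a measure \<Rightarrow> nat set \<Rightarrow> nat set \<Rightarrow> (nat \<Rightarrow> 'a \<Rightarrow> 'b::topological_space) \<Rightarrow> bool" where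
  "markov_given M J I x \<longleftrightarrow>
     (\<forall>k\<in>I. cond_indep M (gen_sigma M (insert k J) x)
              (gen_sigma M {i\<in>I. i < k} x) (gen_sigma M {i\<in>I. k < i} x))"

definition markov ::
    "'a measure \<Rightarrow> nat set \<Rightarrow> (nat \<Rightarrow> 'a \<Rightarrow> 'b::topological_space) \<Rightarrow> bool" where
  "markov M I x \<longleftrightarrow> markov_given M {} I x"

text \<open>
  For \<open>c = 0\<close> the set \<open>{0..N} - {c}\<close> is \<open>[1, N]\<close>, for \<open>c = N\<close> it is \<open>[0, N - 1]\<close>
  (and empty if \<open>N = 0\<close>).
\<close>

definition CM ::
    "'a measure \<Rightarrow> nat \<Rightarrow> nat \<Rightarrow> (nat \<Rightarrow> 'a \<Rightarrow> 'b::topological_space) \<Rightarrow> bool" where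
  "CM M N c x \<longleftrightarrow> markov_given M {c} ({0..N} - {c}) x"

definition stack :: "real ^ 'm \<Rightarrow> real ^ 'n \<Rightarrow> real ^ ('m + 'n)" where
  "stack u v = (\<chi> i. case i of Inl j \<Rightarrow> u $ j | Inr j \<Rightarrow> v $ j)"

end

theory Submission imports Defs begin

text \<open>
  Stacking \<open>x c\<close> onto the states enlarges each segment only by \<open>\<sigma>(x c)\<close>, which lies in the
  conditioning sigma-algebra \<open>\<sigma>(x k, x c) = \<sigma>(y k)\<close>, and such an enlargement preserves
  conditional independence: for fixed \<open>B\<close>, independence of \<open>F\<close> and \<open>B\<close> given \<open>G\<close> says that
  \<open>1\<^sub>B - E[1\<^sub>B | G]\<close> has integral zero over all \<open>A \<inter> D\<close> with \<open>A \<in> F\<close>, \<open>D \<in> G\<close>, hence over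
  all of \<open>\<sigma>(F, G)\<close> by Dynkin's theorem.
\<close>

section \<open>Conditional expectations compared through set integrals\<close>

lemma (in sigma_finite_subalgebra) real_cond_exp_AE_eq_iff:
  assumes "integrable M f" "integrable M g"
  shows "(AE x in M. real_cond_exp M F f x = real_cond_exp M F g x) \<longleftrightarrow>
    (\<forall>D\<in>sets F. (LINT x:D|M. f x) = (LINT x:D|M. g x))"
proof
  assume eq: "AE x in M. real_cond_exp M F f x = real_cond_exp M F g x"
  show "\<forall>D\<in>sets F. (LINT x:D|M. f x) = (LINT x:D|M. g x)"
  proof
    fix D assume D: "D \<in> sets F"
    have "(LINT x:D|M. real_cond_exp M F f x) = (LINT x:D|M. real_cond_exp M F g x)"
      unfolding set_lebesgue_integral_def
      using D subalg eq by (intro integral_cong_AE) (auto simp: subalgebra_def)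
    then show "(LINT x:D|M. f x) = (LINT x:D|M. g x)"
      using D assms by (simp add: real_cond_exp_intA)
  qed
next
  assume "\<forall>D\<in>sets F. (LINT x:D|M. f x) = (LINT x:D|M. g x)"
  \<comment> \<open>The conditional expectation of \<open>g\<close> is \<open>F\<close>-measurable
    and, by the hypothesis, integrates like \<open>f\<close> over every set of \<open>F\<close>.
    Almost sure uniqueness of the conditional expectation of \<open>f\<close> then identifies the
    two.\<close>
  then show "AE x in M. real_cond_exp M F f x = real_cond_exp M F g x"
    using assms by (intro real_cond_exp_charact) (auto simp: real_cond_exp_int real_cond_exp_intA)
qed

text \<open>Writing \<open>h\<close> for the conditional expectation of \<open>indicator B\<close>,
  the \<open>F\<close>-measurable factor \<open>h\<close> can be pulled inside, so the product
  becomes the conditional expectation of \<open>h\<close> times \<open>indicator A\<close>;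
  integrating over \<open>D\<close> gives the claim. The gain is that \<open>A\<close> now enters
  only through the domain of integration \<open>A \<inter> D\<close>, and additively, which opens
  the way to a Dynkin argument.\<close>

lemma (in finite_measure_subalgebra) real_cond_exp_indicator_Int_iff:
  assumes [measurable]: "A \<in> sets M" "B \<in> sets M"
  shows "(AE x in M. real_cond_exp M F (indicator (A \<inter> B)) x =
      real_cond_exp M F (indicator A) x * real_cond_exp M F (indicator B) x) \<longleftrightarrow>
    (\<forall>D\<in>sets F. (LINT x:A \<inter> D|M. indicator B x - real_cond_exp M F (indicator B) x) = 0)"
proof -
  define h where "h = real_cond_exp M F (indicator B)"
  have [measurable]: "h \<in> borel_measurable F"
    by (simp add: h_def)
  have int: "integrable M (indicator C :: _ \<Rightarrow> real)" if "C \<in> sets M" for C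
    using that by (simp add: emeasure_eq_measure)
  have inth: "integrable M h"
    by (simp add: h_def real_cond_exp_int int)
  have set_int: "integrable M (\<lambda>x. indicator C x * f x)"
    if "C \<in> sets M" "integrable M f" for C and f :: "_ \<Rightarrow> real"
    using that integrable_mult_indicator[of C M f] by simp
  have inthA: "integrable M (\<lambda>x. h x * indicator A x)"
    using set_int[of A h] inth by (simp add: mult.commute)
  have "AE x in M. real_cond_exp M F (\<lambda>x. h x * indicator A x) x =
      h x * real_cond_exp M F (indicator A) x"
    by (intro real_cond_exp_mult inthA) auto
  then have "(AE x in M. real_cond_exp M F (indicator (A \<inter> B)) x =
      real_cond_exp M F (indicator A) x * h x) \<longleftrightarrow>
    (AE x in M. real_cond_exp M F (indicator (A \<inter> B)) x =
      real_cond_exp M F (\<lambda>x. h x * indicator A x) x)"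
    by (auto elim!: eventually_elim2 simp: mult.commute)
  also have "\<dots> \<longleftrightarrow> (\<forall>D\<in>sets F. (LINT x:D|M. indicator (A \<inter> B) x) =
      (LINT x:D|M. h x * indicator A x))"
    by (intro real_cond_exp_AE_eq_iff int inthA) auto
  also have "\<dots> \<longleftrightarrow> (\<forall>D\<in>sets F. (LINT x:A \<inter> D|M. indicator B x - h x) = 0)"
  proof (intro ball_cong refl)
    fix D assume "D \<in> sets F"
    then have [measurable]: "D \<in> sets M"
      using subalg by (auto simp: subalgebra_def)
    have "(LINT x:A \<inter> D|M. indicator B x - h x) =
        (LINT x:A \<inter> D|M. indicator B x) - (LINT x:A \<inter> D|M. h x)"
      by (intro set_integral_diff) (auto simp: set_integrable_def int inth set_int)
    also have "(LINT x:A \<inter> D|M. indicator B x) = (LINT x:D|M. indicator (A \<inter> B) x :: real)"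
      by (simp add: set_lebesgue_integral_def indicator_inter_arith mult_ac)
    also have "(LINT x:A \<inter> D|M. h x) = (LINT x:D|M. h x * indicator A x)"
      by (simp add: set_lebesgue_integral_def indicator_inter_arith mult_ac)
    finally show "(LINT x:D|M. indicator (A \<inter> B) x) = (LINT x:D|M. h x * indicator A x) \<longleftrightarrow>
        (LINT x:A \<inter> D|M. indicator B x - h x) = 0"
      by simp
  qed
  finally show ?thesis
    by (simp add: h_def)
qed

text \<open>The sets over which \<open>f\<close> integrates to zero form a Dynkin system: the
  vanishing total integral gives closure under complements, and countable additivity gives closure
  under disjoint unions. As \<open>P\<close> is closed under intersection, the \<pi>-\<lambda>
  theorem applies.\<close>

lemma set_integral_eq_0_sigma_sets:
  fixes f :: "'a \<Rightarrow> real"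
  assumes f: "integrable M f" "(LINT x|M. f x) = 0"
    and P: "Int_stable P" "P \<subseteq> sets M"
    and zero: "\<And>E. E \<in> P \<Longrightarrow> (LINT x:E|M. f x) = 0"
    and E: "E \<in> sigma_sets (space M) P"
  shows "(LINT x:E|M. f x) = 0"
proof -
  have "P \<subseteq> Pow (space M)"
    using P(2) sets.space_closed by auto
  have sig: "sigma_sets (space M) P \<subseteq> sets M"
    using P(2) by (rule sets.sigma_sets_subset)
  have int: "set_integrable M C f" if "C \<in> sigma_sets (space M) P" for C
    using that sig f(1) integrable_mult_indicator[of C M f] by (auto simp: set_integrable_def)
  from P(1) \<open>P \<subseteq> Pow (space M)\<close> E show ?thesis
  proof (induction rule: sigma_sets_induct_disjoint)
    case (basic C)
    then show ?case by (rule zero)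
  next
    case empty
    then show ?case by (simp add: set_lebesgue_integral_def)
  next
    case (compl C)
    have "space M - C \<in> sigma_sets (space M) P"
      using compl(1) by (rule sigma_sets.Compl)
    then have "(LINT x:C \<union> (space M - C)|M. f x) = (LINT x:C|M. f x) + (LINT x:space M - C|M. f x)"
      using compl(1) int by (intro set_integral_Un) auto
    moreover have "C \<union> (space M - C) = space M"
      using compl(1) sig sets.sets_into_space[of C M] by auto
    moreover have "(LINT x:space M|M. f x) = 0"
      using set_integral_space[OF f(1)] f(2) by simp
    ultimately show ?case
      using compl(2) by simp
  next
    case (union C)
    have C: "C i \<in> sigma_sets (space M) P" for i
      using union(2) by auto
    then have "(\<Union>i. C i) \<in> sigma_sets (space M) P"
      by (rule sigma_sets.Union)
    then have "(LINT x:(\<Union>i. C i)|M. f x) = (\<Sum>i. LINT x:C i|M. f x)"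
      using union(1) C sig int
      by (intro lebesgue_integral_countable_add) (auto simp: disjoint_family_on_def)
    then show ?case
      using union(3) by simp
  qed
qed

section \<open>Enlarging one side of a conditional independence\<close>

lemma cond_indep_sym:
  assumes "cond_indep M G F H"
  shows "cond_indep M G H F"
  unfolding cond_indep_def
proof (intro ballI)
  fix A B assume "A \<in> sets H" "B \<in> sets F"
  then have "AE x in M. real_cond_exp M G (indicator (B \<inter> A)) x =
      real_cond_exp M G (indicator B) x * real_cond_exp M G (indicator A) x"
    using assms unfolding cond_indep_def by blast
  then show "AE x in M. real_cond_exp M G (indicator (A \<inter> B)) x =
      real_cond_exp M G (indicator A) x * real_cond_exp M G (indicator B) x"
    by (simp only: Int_commute mult.commute)
qed

lemma cond_indep_mono:
  assumes "cond_indep M G F H" "sets F' \<subseteq> sets F" "sets H' \<subseteq> sets H"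
  shows "cond_indep M G F' H'"
  using assms unfolding cond_indep_def by blast

text \<open>\<open>F'\<close> may be any sub-\<sigma>-algebra of the join of \<open>F\<close> and
  \<open>G\<close>. The intersections \<open>A \<inter> D\<close> are used as generators of the join
  because they form a \<pi>-system.\<close>

lemma cond_indep_join_left:
  assumes "finite_measure_subalgebra M G"
    and F: "subalgebra M F" and H: "subalgebra M H"
    and ci: "cond_indep M G F H"
    and F': "sets F' \<subseteq> sigma_sets (space M) {A \<inter> D | A D. A \<in> sets F \<and> D \<in> sets G}"
  shows "cond_indep M G F' H"
proof -
  interpret finite_measure_subalgebra M G by fact
  let ?P = "{A \<inter> D | A D. A \<in> sets F \<and> D \<in> sets G}"
  have G_sets: "sets G \<subseteq> sets M" "space G = space M"
    using subalg by (auto simp: subalgebra_def)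
  have F_sets: "sets F \<subseteq> sets M" "space F = space M"
    using F by (auto simp: subalgebra_def)
  have P: "?P \<subseteq> sets M"
    using G_sets F_sets by auto
  have stable: "Int_stable ?P"
  proof (rule Int_stableI)
    fix a b assume "a \<in> ?P" "b \<in> ?P"
    then obtain A D A' D' where "a = A \<inter> D" "b = A' \<inter> D'"
      "A \<in> sets F" "D \<in> sets G" "A' \<in> sets F" "D' \<in> sets G" by blast
    then show "a \<inter> b \<in> ?P"
      by (intro CollectI exI[of _ "A \<inter> A'"] exI[of _ "D \<inter> D'"]) auto
  qed
  have G_P: "sets G \<subseteq> ?P"
  proof
    fix D assume "D \<in> sets G"
    then have "D = space F \<inter> D"
      using sets.sets_into_space[of D G] G_sets(2) F_sets(2) by auto
    then show "D \<in> ?P"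
      using \<open>D \<in> sets G\<close> sets.top[of F] by blast
  qed
  interpret S: sigma_algebra "space M" "sigma_sets (space M) ?P"
    using P sets.space_closed[of M] by (intro sigma_algebra_sigma_sets) (rule subset_trans)
  show ?thesis
    unfolding cond_indep_def
  proof (intro ballI)
    fix A B assume A: "A \<in> sets F'" and B: "B \<in> sets H"
    then have B_M[measurable]: "B \<in> sets M"
      using H by (auto simp: subalgebra_def)
    have A_M: "A \<in> sets M"
      using A F' sets.sigma_sets_subset[OF P] by auto
    let ?f = "\<lambda>x. indicator B x - real_cond_exp M G (indicator B) x"
    have int_B: "integrable M (indicator B :: _ \<Rightarrow> real)"
      by (simp add: emeasure_eq_measure)
    \<comment> \<open>Conditional expectation preserves the integral; this is the vanishing total
      that the Dynkin argument uses for complements.\<close>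
    have f: "integrable M ?f" "(LINT x|M. ?f x) = 0"
      using int_B by (auto simp: real_cond_exp_int)
    have "(LINT x:E|M. ?f x) = 0" if "E \<in> ?P" for E
    proof -
      from that obtain C D where E: "E = C \<inter> D" and C: "C \<in> sets F" and D: "D \<in> sets G"
        by blast
      have C_M: "C \<in> sets M"
        using C F_sets by auto
      from ci C B have "AE x in M. real_cond_exp M G (indicator (C \<inter> B)) x =
          real_cond_exp M G (indicator C) x * real_cond_exp M G (indicator B) x"
        unfolding cond_indep_def by blast
      then show ?thesis
        unfolding real_cond_exp_indicator_Int_iff[OF C_M B_M] using D E by blast
    qed
    note zero = set_integral_eq_0_sigma_sets[OF f stable P this]
    show "AE x in M. real_cond_exp M G (indicator (A \<inter> B)) x =
        real_cond_exp M G (indicator A) x * real_cond_exp M G (indicator B) x"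
      unfolding real_cond_exp_indicator_Int_iff[OF A_M B_M]
    proof
      \<comment> \<open>For \<open>A\<close> in the join, \<open>A \<inter> D\<close> need not be a
        generator, but it stays in the join because \<open>D\<close> lies there too.\<close>
      fix D assume "D \<in> sets G"
      then have "D \<in> sigma_sets (space M) ?P"
        using G_P by (auto intro: sigma_sets.Basic)
      moreover have "A \<in> sigma_sets (space M) ?P"
        using A F' by blast
      ultimately show "(LINT x:A \<inter> D|M. ?f x) = 0"
        by (intro zero S.Int)
    qed
  qed
qed

section \<open>Generated \<sigma>-algebras\<close>

lemma space_gen_sigma [simp]: "space (gen_sigma M I x) = space M"
  unfolding gen_sigma_def by (rule space_measure_of) auto

lemma sets_gen_sigma:
  "sets (gen_sigma M I x) =
    sigma_sets (space M) {x i -` A \<inter> space M | i A. i \<in> I \<and> A \<in> sets borel}"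
  unfolding gen_sigma_def by (rule sets_measure_of) auto

text \<open>\<open>sigma\<close> carries the zero measure, so agreement of the measurable sets
  already makes the two measure objects equal. Equality of the objects is what permits rewriting the
  conditioning argument of \<open>cond_indep\<close>.\<close>

lemma gen_sigma_eqI:
  "sets (gen_sigma M I x) = sets (gen_sigma M J y) \<Longrightarrow> gen_sigma M I x = gen_sigma M J y"
  unfolding sets_gen_sigma unfolding gen_sigma_def by (rule sigma_eqI) auto

lemma measurable_gen_sigma: "i \<in> I \<Longrightarrow> x i \<in> borel_measurable (gen_sigma M I x)"
  by (rule measurableI) (auto simp: sets_gen_sigma)

lemma sets_gen_sigma_subset:
  assumes "\<And>i. i \<in> I \<Longrightarrow> x i \<in> borel_measurable G" "space G = space M"
  shows "sets (gen_sigma M I x) \<subseteq> sets G"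
  unfolding sets_gen_sigma assms(2)[symmetric]
  by (rule sets.sigma_sets_subset) (auto intro: measurable_sets assms(1))

lemma subalgebra_gen_sigma:
  assumes "\<And>i. i \<in> I \<Longrightarrow> x i \<in> borel_measurable M"
  shows "subalgebra M (gen_sigma M I x)"
  unfolding subalgebra_def by (intro conjI sets_gen_sigma_subset assms) simp_all

section \<open>Stacked states and what they generate\<close>

lemma borel_measurable_stack:
  assumes "u \<in> borel_measurable G" "v \<in> borel_measurable G"
  shows "(\<lambda>\<omega>. stack (u \<omega>) (v \<omega>)) \<in> borel_measurable G"
proof (rule borel_measurable_continuous_Pair[OF assms])
  show "continuous_on UNIV (\<lambda>p :: (real ^ 'm) \<times> (real ^ 'n). stack (fst p) (snd p))"
    unfolding stack_def
  proof (rule continuous_on_vec_lambda)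
    fix i :: "'m + 'n"
    show "continuous_on UNIV (\<lambda>p :: (real ^ 'm) \<times> (real ^ 'n).
        case i of Inl j \<Rightarrow> fst p $ j | Inr j \<Rightarrow> snd p $ j)"
      by (cases i) (auto intro!: continuous_intros)
  qed
qed

lemma borel_measurable_stackD:
  assumes "(\<lambda>\<omega>. stack (u \<omega>) (v \<omega>)) \<in> borel_measurable G"
  shows "u \<in> borel_measurable G" "v \<in> borel_measurable G"
proof -
  \<comment> \<open>The two blocks are recovered by continuous coordinate projections.\<close>
  have "(\<lambda>\<omega>. \<chi> j. stack (u \<omega>) (v \<omega>) $ Inl j) \<in> borel_measurable G"
    "(\<lambda>\<omega>. \<chi> j. stack (u \<omega>) (v \<omega>) $ Inr j) \<in> borel_measurable G"
    by (rule borel_measurable_continuous_on[OF _ assms], intro continuous_intros)+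
  then show "u \<in> borel_measurable G" "v \<in> borel_measurable G"
    by (simp_all add: stack_def)
qed

text \<open>This matches the conditioning on both sides of the theorem: knowing the stacked state at
  \<open>k\<close> amounts to knowing \<open>x k\<close> and \<open>x c\<close>.\<close>

lemma gen_sigma_stack_singleton:
  "gen_sigma M {k} (\<lambda>k \<omega>. stack (x k \<omega>) (x c \<omega>)) = gen_sigma M {k, c} x"
  (is "gen_sigma M {k} ?y = _")
proof (intro gen_sigma_eqI equalityI sets_gen_sigma_subset)
  show "?y i \<in> borel_measurable (gen_sigma M {k, c} x)" if "i \<in> {k}" for i
    using that by (intro borel_measurable_stack measurable_gen_sigma) auto
  show "x i \<in> borel_measurable (gen_sigma M {k} ?y)" if "i \<in> {k, c}" for i
    using borel_measurable_stackD[OF measurable_gen_sigma[of k "{k}" ?y M]] that by auto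
qed simp_all

lemma sets_gen_sigma_stack_superset:
  "sets (gen_sigma M I x) \<subseteq> sets (gen_sigma M I (\<lambda>k \<omega>. stack (x k \<omega>) (x c \<omega>)))"
  (is "_ \<subseteq> sets (gen_sigma M I ?y)")
proof (rule sets_gen_sigma_subset)
  show "x i \<in> borel_measurable (gen_sigma M I ?y)" if "i \<in> I" for i
    using borel_measurable_stackD(1)[OF measurable_gen_sigma[of i I ?y M, OF that]] .
qed simp

text \<open>Only an inclusion can be claimed: for empty \<open>I\<close> the left side is trivial,
  whereas the right side still contains all of \<sigma>(\<open>x c\<close>).\<close>

lemma sets_gen_sigma_stack_subset:
  assumes "c \<in> J"
  shows "sets (gen_sigma M I (\<lambda>k \<omega>. stack (x k \<omega>) (x c \<omega>))) \<subseteq>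
    sigma_sets (space M) {A \<inter> D | A D. A \<in> sets (gen_sigma M I x) \<and> D \<in> sets (gen_sigma M J x)}"
  (is "_ \<subseteq> sigma_sets _ ?P")
proof -
  have "?P \<subseteq> Pow (space M)"
    using sets.sets_into_space[of _ "gen_sigma M I x"] by auto
  note S_sets = sets_measure_of[OF this] and S_space = space_measure_of[OF this]
  let ?S = "sigma (space M) ?P"
  have top: "space M \<in> sets (gen_sigma M K x)" for K
    using sets.top[of "gen_sigma M K x"] by simp
  \<comment> \<open>Taking the whole space as the other factor puts both \<sigma>-algebras among the
    generators.\<close>
  have "A \<in> ?P" if "A \<in> sets (gen_sigma M I x)" for A
    using that top sets.sets_into_space[OF that] by (intro CollectI exI[of _ A] exI[of _ "space M"]) auto
  moreover have "D \<in> ?P" if "D \<in> sets (gen_sigma M J x)" for D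
    using that top sets.sets_into_space[OF that] by (intro CollectI exI[of _ "space M"] exI[of _ D]) auto
  ultimately have "sets (gen_sigma M I x) \<subseteq> ?P" "sets (gen_sigma M J x) \<subseteq> ?P"
    by (simp_all only: subset_iff) blast+
  then have sub: "subalgebra ?S (gen_sigma M I x)" "subalgebra ?S (gen_sigma M J x)"
    by (auto simp: subalgebra_def S_sets S_space intro!: sigma_sets.Basic)
  have "sets (gen_sigma M I (\<lambda>k \<omega>. stack (x k \<omega>) (x c \<omega>))) \<subseteq> sets ?S"
  proof (rule sets_gen_sigma_subset)
    show "(\<lambda>\<omega>. stack (x i \<omega>) (x c \<omega>)) \<in> borel_measurable ?S" if "i \<in> I" for i
      using that assms sub
      by (auto intro!: borel_measurable_stack intro: measurable_from_subalg measurable_gen_sigma)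
  qed (simp add: S_space)
  then show ?thesis
    by (simp add: S_sets)
qed

theorem corollary3p4:
  fixes M :: "'a measure" and N c :: nat and x :: "nat \<Rightarrow> 'a \<Rightarrow> real ^ 'd"
  assumes "prob_space M"
    and "gaussian_seq M {0..N} x"
    and "c \<in> {0, N}"
  shows "CM M N c x \<longleftrightarrow> markov M ({0..N} - {c}) (\<lambda>k \<omega>. stack (x k \<omega>) (x c \<omega>))"
proof -
  let ?I = "{0..N} - {c}" and ?y = "\<lambda>k \<omega>. stack (x k \<omega>) (x c \<omega>)"
  have meas: "x i \<in> borel_measurable M" if "i \<le> N" for i
    using assms(2) that by (simp add: gaussian_seq_def)
  have "c \<le> N"
    using assms(3) by auto
  have "cond_indep M (gen_sigma M {k, c} x) (gen_sigma M {i\<in>?I. i < k} x) (gen_sigma M {i\<in>?I. k < i} x)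
      \<longleftrightarrow> cond_indep M (gen_sigma M {k, c} x) (gen_sigma M {i\<in>?I. i < k} ?y) (gen_sigma M {i\<in>?I. k < i} ?y)"
    (is "cond_indep M ?G ?F ?H \<longleftrightarrow> cond_indep M ?G ?F' ?H'")
    if "k \<in> ?I" for k
  proof
    assume ci: "cond_indep M ?G ?F ?H"
    have sub: "subalgebra M ?G" "subalgebra M ?F" "subalgebra M ?H"
      using that \<open>c \<le> N\<close> by (auto intro!: subalgebra_gen_sigma meas)
    have "?y i \<in> borel_measurable M" if "i \<le> N" for i
      using that \<open>c \<le> N\<close> by (intro borel_measurable_stack meas)
    then have sub': "subalgebra M ?F'"
      by (intro subalgebra_gen_sigma) auto
    have G: "finite_measure_subalgebra M ?G"
      using assms(1) sub(1)
      by (simp add: finite_measure_subalgebra_def finite_measure_subalgebra_axioms_def prob_space_def)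
    \<comment> \<open>The segments are enlarged one after the other: first the past, then, with the
      roles swapped by symmetry, the future against the already enlarged past.\<close>
    have "cond_indep M ?G ?F' ?H"
      using G sub(2,3) ci by (rule cond_indep_join_left) (rule sets_gen_sigma_stack_subset, simp)
    then have "cond_indep M ?G ?H ?F'"
      by (rule cond_indep_sym)
    with G sub(3) sub' have "cond_indep M ?G ?H' ?F'"
      by (rule cond_indep_join_left) (rule sets_gen_sigma_stack_subset, simp)
    then show "cond_indep M ?G ?F' ?H'"
      by (rule cond_indep_sym)
  next
    \<comment> \<open>Each \<open>x i\<close> is a block of the stacked state, so this direction
      merely shrinks both segments.\<close>
    assume "cond_indep M ?G ?F' ?H'"
    then show "cond_indep M ?G ?F ?H"
      by (rule cond_indep_mono) (rule sets_gen_sigma_stack_superset)+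
  qed
  then show ?thesis
    unfolding CM_def markov_def markov_given_def gen_sigma_stack_singleton by (intro ball_cong) auto
qed

end
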